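(* Let $n$ be a positive integer and let $\frac{c}{d}\in[0,1]$ be an irreducible fraction. Then $\mathcal{M}_{\frac{c}{d}}(n)=2^n$.
   Context: $[n]=\{1,\ldots,n\}$ and $2^{[n]}$ is its power set. A pair $(\mathcal{A},\mathcal{B})$ of families of subsets of $[n]$ (i.e. $\mathcal{A},\mathcal{B}\subseteq 2^{[n]}$) is a $\frac{c}{d}$-cross intersecting pair if $|A\cap B|=\frac{c}{d}|B|$ for every $A\in\mathcal{A}$ and every $B\in\mathcal{B}$. $\mathcal{M}_{\frac{c}{d}}(n)$ denotes the maximum value of $|\mathcal{A}||\mathcal{B}|$ over all $\frac{c}{d}$-cross intersecting pairs $(\mathcal{A},\mathcal{B})$ of families of subsets of $[n]$. *)

theory Defs
  imports Complex_Main
begin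

definition cross_intersecting_pair ::
  "nat \<Rightarrow> nat \<Rightarrow> nat \<Rightarrow> nat set set \<Rightarrow> nat set set \<Rightarrow> bool" where
  "cross_intersecting_pair c d n \<A> \<B> \<longleftrightarrow>
     \<A> \<subseteq> Pow {1..n} \<and> \<B> \<subseteq> Pow {1..n} \<and>
     (\<forall>A\<in>\<A>. \<forall>B\<in>\<B>. real (card (A \<inter> B)) = real c / real d * real (card B))"

text \<open>The set of products below is finite (both families are subsets of the finite
  set \<open>Pow {1..n}\<close>) and contains 0 (take an empty family), so \<open>Max\<close> is a genuine maximum.\<close>

definition max_cross_product :: "nat \<Rightarrow> nat \<Rightarrow> nat \<Rightarrow> nat" where
  "max_cross_product c d n =
     Max {card \<A> * card \<B> | \<A> \<B>. cross_intersecting_pair c d n \<A> \<B>}"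

end

theory Submission
  imports Defs
begin

text \<open>
  The lower bound is attained by \<open>Pow {1..n}\<close> against \<open>{{}}\<close>. The upper bound
  comes from the fact that, for each \<open>B\<close> in the second family, the number \<open>card (A \<inter> B)\<close> is the
  same for all \<open>A\<close> in the first.

  Behind the bound is duality: identify sets with their characteristic vectors and let \<open>k\<close> be
  the dimension of the span of the second family. Differences of members of the first family are
  orthogonal to that span, so the first family lies in a translate of a space of dimension
  \<open>n - k\<close>. Since a \<open>k\<close>-dimensional affine space contains at most \<open>2 ^ k\<close> zero-one vectors, the
  product of the sizes is at most \<open>2 ^ k * 2 ^ (n - k)\<close>.

  The proof replaces dimension by a combinatorial choice: a minimal set \<open>S\<close> of coordinates whose
  traces already distinguish the members of the second family. That family then has at most
  \<open>2 ^ card S\<close> members. By minimality, each \<open>j \<in> S\<close> comes with two members whose traces on \<open>S\<close>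
  differ in \<open>j\<close> alone. Two members of the first family that agree outside \<open>S\<close> must also agree
  at \<open>j\<close>, as passing from one trace to the other would otherwise change the two intersection
  sizes by different amounts (\<open>same_membership_at_trace_difference\<close>). Hence the first family is
  distinguished by its traces on the complement of \<open>S\<close>
  (\<open>card_mult_card_le_of_constant_intersections\<close>).
\<close>

lemma card_le_of_inj_on_trace:
  assumes "finite S" and "inj_on (\<lambda>B. B \<inter> S) \<F>"
  shows "card \<F> \<le> 2 ^ card S"
proof -
  have "card \<F> \<le> card (Pow S)"
    using assms by (intro card_inj_on_le[of "\<lambda>B. B \<inter> S"]) auto
  then show ?thesis
    using assms(1) by (simp add: card_Pow)
qed

text \<open>
  Write \<open>T\<close> for the trace of \<open>B'\<close> on \<open>S\<close>, so that \<open>B\<close> has trace \<open>insert j T\<close>. Because \<open>A\<close> and \<open>A'\<close>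
  agree outside \<open>S\<close>, equal intersection sizes with \<open>B\<close> and with \<open>B'\<close> mean equal intersection
  sizes with \<open>insert j T\<close> and with \<open>T\<close>; subtracting leaves the membership of \<open>j\<close>.
\<close>

lemma same_membership_at_trace_difference:
  assumes "finite B" "finite B'"
    and agree: "A - S = A' - S"
    and B: "card (A \<inter> B) = card (A' \<inter> B)"
    and B': "card (A \<inter> B') = card (A' \<inter> B')"
    and trace: "B \<inter> S = insert j (B' \<inter> S)" and "j \<notin> B'"
  shows "j \<in> A \<longleftrightarrow> j \<in> A'"
proof -
  define T where "T = B' \<inter> S"
  have split: "card (X \<inter> C) = card (X \<inter> (C \<inter> S)) + card ((X - S) \<inter> C)"
    if "finite C" for X C
  proof -
    have "card (X \<inter> (C \<inter> S) \<union> (X - S) \<inter> C) = card (X \<inter> (C \<inter> S)) + card ((X - S) \<inter> C)"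
      using that by (intro card_Un_disjoint) auto
    moreover have "X \<inter> (C \<inter> S) \<union> (X - S) \<inter> C = X \<inter> C"
      by blast
    ultimately show ?thesis
      by simp
  qed
  have "card (A \<inter> insert j T) = card (A' \<inter> insert j T)"
    using B split[OF assms(1), of A] split[OF assms(1), of A'] agree trace
    by (simp add: T_def)
  moreover have "card (A \<inter> T) = card (A' \<inter> T)"
    using B' split[OF assms(2), of A] split[OF assms(2), of A'] agree by (simp add: T_def)
  moreover have "finite T" "j \<notin> T"
    using assms by (auto simp: T_def)
  ultimately show ?thesis
    by (auto simp: Int_insert_right split: if_splits)
qed

text \<open>
  A minimal set \<open>S\<close> of coordinates separating \<open>\<B>\<close> plays the role of a basis: by minimality no
  coordinate in \<open>S\<close> is determined by the others on \<open>\<B>\<close>, and this forces the coordinates outside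
  \<open>S\<close> to separate \<open>\<A>\<close>. The two exponents are then complementary.
\<close>

lemma card_mult_card_le_of_constant_intersections:
  assumes "finite X" and \<A>: "\<A> \<subseteq> Pow X" and \<B>: "\<B> \<subseteq> Pow X"
    and const: "\<And>A A' B. A \<in> \<A> \<Longrightarrow> A' \<in> \<A> \<Longrightarrow> B \<in> \<B> \<Longrightarrow> card (A \<inter> B) = card (A' \<inter> B)"
  shows "card \<A> * card \<B> \<le> 2 ^ card X"
proof -
  define distinguishing where
    "distinguishing S \<longleftrightarrow> S \<subseteq> X \<and> inj_on (\<lambda>B. B \<inter> S) \<B>" for S
  have "distinguishing X"
    using \<B> by (auto simp: distinguishing_def inj_on_def)
  then obtain S where S: "distinguishing S"
    and minimal: "\<And>R. distinguishing R \<Longrightarrow> card S \<le> card R"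
    using ex_has_least_nat[of distinguishing X card] by blast
  have "S \<subseteq> X" and inj_\<B>: "inj_on (\<lambda>B. B \<inter> S) \<B>"
    using S by (auto simp: distinguishing_def)
  have "finite S"
    using \<open>S \<subseteq> X\<close> assms(1) by (rule finite_subset)
  have inj_\<A>: "inj_on (\<lambda>A. A \<inter> (X - S)) \<A>"
  proof (rule inj_onI)
    fix A A' assume A: "A \<in> \<A>" "A' \<in> \<A>" and "A \<inter> (X - S) = A' \<inter> (X - S)"
    then have agree: "A - S = A' - S"
      using \<A> by blast
    have "j \<in> A \<longleftrightarrow> j \<in> A'" if "j \<in> S" for j
    proof -
      have "card (S - {j}) < card S"
        using \<open>finite S\<close> that by (rule card_Diff1_less)
      then have "\<not> distinguishing (S - {j})"
        using minimal leD by blast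
      then obtain B B' where BB': "B \<in> \<B>" "B' \<in> \<B>" "B \<noteq> B'"
        "B \<inter> (S - {j}) = B' \<inter> (S - {j})"
        using \<open>S \<subseteq> X\<close> by (auto simp: distinguishing_def inj_on_def)
      then have "B \<inter> S \<noteq> B' \<inter> S"
        using inj_\<B> unfolding inj_on_def by blast
      then have "j \<notin> B' \<and> B \<inter> S = insert j (B' \<inter> S) \<or> j \<notin> B \<and> B' \<inter> S = insert j (B \<inter> S)"
        using BB'(4) that by blast
      moreover have "finite B" "finite B'"
        using BB'(1,2) \<B> finite_subset[OF _ assms(1)] by blast+
      moreover have "card (A \<inter> B) = card (A' \<inter> B)" "card (A \<inter> B') = card (A' \<inter> B')"
        using const[OF A] BB'(1,2) by auto
      ultimately show ?thesis
        using same_membership_at_trace_difference[of B B' A S A' j]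
          same_membership_at_trace_difference[of B' B A S A' j] agree by argo
    qed
    with agree show "A = A'"
      by blast
  qed
  have "card \<A> * card \<B> \<le> 2 ^ card (X - S) * 2 ^ card S"
    using card_le_of_inj_on_trace[OF _ inj_\<A>] card_le_of_inj_on_trace[OF \<open>finite S\<close> inj_\<B>]
      assms(1) by (intro mult_mono) auto
  also have "\<dots> = 2 ^ card X"
    using \<open>S \<subseteq> X\<close> assms(1) \<open>finite S\<close> card_mono[of X S]
    by (simp add: card_Diff_subset flip: power_add)
  finally show ?thesis .
qed

theorem theorem1p1:
  fixes n c d :: nat
  assumes "n > 0"
    and "d > 0"
    and "coprime c d"
    and "real c / real d \<in> {0..1}"
  shows "max_cross_product c d n = 2 ^ n"
proof -
  let ?P = "{card \<A> * card \<B> | \<A> \<B>. cross_intersecting_pair c d n \<A> \<B>}"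
  have bound: "m \<le> 2 ^ n" if m: "m \<in> ?P" for m
  proof -
    obtain \<A> \<B> where m: "m = card \<A> * card \<B>" and pair: "cross_intersecting_pair c d n \<A> \<B>"
      using m by blast
    have const: "card (A \<inter> B) = card (A' \<inter> B)" if "A \<in> \<A>" "A' \<in> \<A>" "B \<in> \<B>" for A A' B
    proof -
      have "real (card (A \<inter> B)) = real (card (A' \<inter> B))"
        using pair that by (simp add: cross_intersecting_pair_def)
      then show ?thesis
        by simp
    qed
    have "\<A> \<subseteq> Pow {1..n}" "\<B> \<subseteq> Pow {1..n}"
      using pair by (simp_all add: cross_intersecting_pair_def)
    then have "card \<A> * card \<B> \<le> 2 ^ card {1..n}"
      by (rule card_mult_card_le_of_constant_intersections[OF finite_atLeastAtMost]) (rule const)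
    then show ?thesis
      by (simp add: m)
  qed
  have "cross_intersecting_pair c d n (Pow {1..n}) {{}}"
    by (simp add: cross_intersecting_pair_def)
  then have "card (Pow {1..n}) * card {{} :: nat set} \<in> ?P"
    by blast
  then have attained: "2 ^ n \<in> ?P"
    by (simp add: card_Pow)
  have "?P \<subseteq> {..2 ^ n}"
    by (rule subsetI, unfold atMost_iff) (rule bound)
  then have "finite ?P"
    by (rule finite_subset) simp
  then show ?thesis
    unfolding max_cross_product_def using bound attained by (rule Max_eqI)
qed

end
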